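(* Let $k,n\in\mathbb N$ with $k>n$. Let $C$ be a connected component of $\mathcal G^{\mathbb C}_{k,n}$. Then $(\pi^{\mathbb C}_{k,n})^{-1}(C)$ is connected. Thus, $\mathcal F^{\mathbb C}_{k,n}$ and $\mathcal G^{\mathbb C}_{k,n}$ have the same number of connected components; in particular, $\mathcal F^{\mathbb C}_{k,n}$ is connected if and only if $\mathcal G^{\mathbb C}_{k,n}$ is connected. Furthermore, $\mathcal F^{\mathbb C}_{k,n}$ is connected if and only if $\mathcal F^{\mathbb C}_{k,k-n}$ is connected.
   Context: $\mathbb N=\{1,2,\dots\}$. $\mathcal F^{\mathbb C}_{k,n}$ is the space of spherical tight frames of $k$ vectors in $\mathbb C^n$: all ordered lists $F=(f_1,\dots,f_k)$ of unit vectors in $\mathbb C^n$ for which there is $B>0$ with $\sum_{i=1}^k|\langle v,f_i\rangle|^2=B\|v\|^2$ for all $v\in\mathbb C^n$, with the relative topology from $(\mathbb C^n)^k$; $F$ is identified with the $n\times k$ matrix with columns $f_1,\dots,f_k$. $\mathcal G^{\mathbb C}_{k,n}=\{\frac kn P\mid P\in M_k(\mathbb C)$ a projection (self-adjoint idempotent) of rank $n$, $P_{ii}=\frac nk$ for $1\le i\le k\}$, with the relative topology from $M_k(\mathbb C)$. $\pi^{\mathbb C}_{k,n}:\mathcal F^{\mathbb C}_{k,n}\to\mathcal G^{\mathbb C}_{k,n}$ is the map $F\mapsto F^*F$. *)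

theory Defs
  imports "HOL-Analysis.Analysis" "HOL-Library.Equipollence"
begin

(* The inner product on Isabelle's type complex ^ 'n is the underlying real one,
   so the sesquilinear one is defined here (linear in the first argument).
   The library norm on complex ^ 'n is already the Hermitian one. *)
definition cinner :: "complex ^ 'n \<Rightarrow> complex ^ 'n \<Rightarrow> complex"
  where "cinner v w = (\<Sum>j\<in>UNIV. v $ j * cnj (w $ j))"

definition conj_transpose :: "complex ^ 'n ^ 'm \<Rightarrow> complex ^ 'm ^ 'n"
  where "conj_transpose A = (\<chi> i j. cnj (A $ j $ i))"

(* Lists of k vectors in C^n, with k = CARD('k) and n = CARD('n): a matrix
   F :: complex ^ 'k ^ 'n has n rows and k columns, and f_i is column i F. *)
definition spherical_tight_frames :: "(complex ^ 'k ^ 'n) set"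
  where "spherical_tight_frames =
    {F. (\<forall>i. norm (column i F) = 1) \<and>
        (\<exists>B>0. \<forall>v. (\<Sum>i\<in>UNIV. (cmod (cinner v (column i F)))\<^sup>2) = B * (norm v)\<^sup>2)}"

definition is_projection :: "complex ^ 'k ^ 'k \<Rightarrow> bool"
  where "is_projection P \<longleftrightarrow> conj_transpose P = P \<and> P ** P = P"

(* Here n is only a rank, so it is a natural number rather than a type. *)
definition frame_grams :: "nat \<Rightarrow> (complex ^ 'k ^ 'k) set"
  where "frame_grams n =
    {(real CARD('k) / real n) *\<^sub>R P | P.
       is_projection P \<and> rank P = n \<and>
       (\<forall>i. P $ i $ i = of_real (real n / real CARD('k)))}"

definition gram_map :: "complex ^ 'k ^ 'n \<Rightarrow> complex ^ 'k ^ 'k"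
  where "gram_map F = conj_transpose F ** F"

end

theory Submission
  imports Defs "HOL-Computational_Algebra.Polynomial"
begin

text \<open>
  Write $k$ and $n$ for the cardinalities of the index types. A matrix $F$ is a spherical tight
  frame iff its columns are unit vectors and $F F^* = (k/n) I$ (\<open>spherical_tight_frame_iff\<close>;
  comparing traces forces the frame bound to be $k/n$). The Gram map $F \<mapsto> F^* F$ sends the
  spherical tight frames onto \<open>frame_grams\<close> (\<open>gram_map_image\<close>): given a projection of rank $n$,
  writing it as a sum of $n$ orthonormal rank one projections yields the $n$ rows of a frame.

  If $F^* F = H^* H$ then $U = (n/k) H F^*$ is unitary and $H = U F$, so each fibre of the Gram map
  is an orbit of the unitary group $U(n)$. Since $U(n)$ is connected, the fibres are connected
  (\<open>connected_gram_map_fibre\<close>). The space of spherical tight frames is compact, so the Gram map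
  is closed, and a closed continuous surjection with connected fibres pulls connected sets back to
  connected sets (\<open>connected_gram_map_preimage\<close>). Taking preimages is then a bijection between
  the components of the two spaces (\<open>components_eqpoll_of_connected_preimages\<close>).

  Finally $P \<mapsto> I - P$ exchanges projections of rank $n$ with diagonal $n/k$ and projections of rank
  $k - n$ with diagonal $(k-n)/k$, which relates the spaces of Gram matrices for $n$ and $k - n$
  (\<open>frame_grams_complement\<close>). Here the rank condition takes care of itself, because the rank of a
  projection is its trace (\<open>rank_projection\<close>).

  Connectedness of $U(n)$ is obtained without diagonalisation. For a unitary $W$ without eigenvalue
  $-1$, the Moebius path $s \<mapsto> (sI + W)(I + sW)^{-1}$, $0 \<le> s \<le> 1$, stays in $U(n)$ and leads from
  $W$ to $I$; an arbitrary unitary becomes such a $W$ after multiplication by a suitable scalar on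
  the unit circle, which is itself connected.
\<close>

section \<open>Algebra of conjugate transposes\<close>

lemma conj_transpose_nth [simp]: "conj_transpose A $ i $ j = cnj (A $ j $ i)"
  by (simp add: conj_transpose_def)

lemma conj_transpose_conj_transpose [simp]: "conj_transpose (conj_transpose A) = A"
  by (simp add: vec_eq_iff)

lemma conj_transpose_mult: "conj_transpose (A ** B) = conj_transpose B ** conj_transpose A"
  by (simp add: vec_eq_iff matrix_matrix_mult_def mult.commute)

lemma conj_transpose_add: "conj_transpose (A + B) = conj_transpose A + conj_transpose B"
  by (simp add: vec_eq_iff)

lemma conj_transpose_diff: "conj_transpose (A - B) = conj_transpose A - conj_transpose B"
  by (simp add: vec_eq_iff)

lemma conj_transpose_scaleR: "conj_transpose (c *\<^sub>R A) = c *\<^sub>R conj_transpose A"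
  by (simp add: vec_eq_iff)

lemma conj_transpose_0 [simp]: "conj_transpose 0 = 0"
  by (simp add: vec_eq_iff)

lemma conj_transpose_mat_1 [simp]: "conj_transpose (mat 1) = mat 1"
  by (auto simp: vec_eq_iff mat_def)

lemma scaleR_mat_1: "c *\<^sub>R mat 1 = (mat (of_real c) :: complex ^ 'n ^ 'n)"
  by (simp add: vec_eq_iff mat_def of_real_def)

lemma mat_mult_nth: "(mat c ** A) $ i $ j = c * (A $ i $ j :: complex)"
  by (simp add: matrix_matrix_mult_def mat_def if_distrib if_distribR cong: if_cong)

lemma matrix_mult_zero_right [simp]: "A ** 0 = (0 :: 'a::semiring_1 ^ 'p ^ 'm)"
  by (simp add: vec_eq_iff matrix_matrix_mult_def)

lemma matrix_mult_zero_left [simp]: "0 ** A = (0 :: 'a::semiring_1 ^ 'p ^ 'm)"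
  by (simp add: vec_eq_iff matrix_matrix_mult_def)

lemma matrix_diff_ldistrib: "A ** (B - C) = A ** B - A ** (C :: 'a::ring_1 ^ 'n ^ 'm)"
  by (simp add: vec_eq_iff matrix_matrix_mult_def right_diff_distrib sum_subtractf)

lemma matrix_diff_rdistrib: "(A - B) ** C = A ** C - B ** (C :: 'a::ring_1 ^ 'n ^ 'm)"
  by (simp add: vec_eq_iff matrix_matrix_mult_def left_diff_distrib sum_subtractf)

lemma matrix_add_rdistrib: "(A + B) ** C = A ** C + B ** (C :: 'a::semiring_1 ^ 'n ^ 'm)"
  by (simp add: vec_eq_iff matrix_matrix_mult_def distrib_right sum.distrib)

lemma continuous_on_conj_transpose [continuous_intros]:
  assumes "continuous_on S f"
  shows "continuous_on S (\<lambda>x. conj_transpose (f x))"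
  unfolding conj_transpose_def using assms by (intro continuous_intros)

lemma continuous_on_matrix_mult [continuous_intros]:
  fixes f :: "_ \<Rightarrow> 'a::real_normed_algebra_1 ^ 'n ^ 'm" and g :: "_ \<Rightarrow> 'a ^ 'p ^ 'n"
  assumes "continuous_on S f" "continuous_on S g"
  shows "continuous_on S (\<lambda>x. f x ** g x)"
  unfolding matrix_matrix_mult_def using assms by (intro continuous_intros)

section \<open>The Hermitian form and the frame condition\<close>

lemma cinner_self: "cinner v v = of_real ((norm v)\<^sup>2)"
  by (simp add: cinner_def norm_vec_def L2_set_def sum_nonneg complex_norm_square del: of_real_power)

lemma cinner_add_left: "cinner (u + v) w = cinner u w + cinner v w"
  by (simp add: cinner_def distrib_right sum.distrib)

lemma cinner_diff_left: "cinner (u - v) w = cinner u w - cinner v w"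
  by (simp add: cinner_def left_diff_distrib sum_subtractf)

lemma cinner_add_right: "cinner w (u + v) = cinner w u + cinner w v"
  by (simp add: cinner_def distrib_left sum.distrib)

lemma cinner_sum_left: "cinner (\<Sum>i\<in>I. f i) w = (\<Sum>i\<in>I. cinner (f i) w)"
  by (simp add: cinner_def sum_distrib_right sum.swap[of _ I])

lemma cinner_scale_left: "cinner (c *s v) w = c * cinner v w"
  by (simp add: cinner_def sum_distrib_left mult_ac)

lemma cinner_scale_right: "cinner v (c *s w) = cnj c * cinner v w"
  by (simp add: cinner_def sum_distrib_left mult_ac)

lemma cinner_adjoint: "cinner (A *v v) w = cinner v (conj_transpose A *v w)"
  unfolding cinner_def matrix_vector_mult_def
  by (simp add: sum_distrib_left sum_distrib_right mult_ac) (rule sum.swap)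

lemma cinner_axis_right: "cinner v (axis i 1) = v $ i"
  by (simp add: cinner_def axis_def if_distrib cong: if_cong)

text \<open>Polarisation: over the complex numbers no symmetry of \<open>M\<close> is needed.\<close>

lemma quadratic_form_zero_imp_zero:
  fixes M :: "complex ^ 'n ^ 'n"
  assumes "\<And>v. cinner (M *v v) v = 0"
  shows "M = 0"
proof -
  have "cinner (M *v v) w = 0" for v w
  proof -
    have "cinner (M *v v) w + cinner (M *v w) v = 0"
      using assms[of "v + w"] assms[of v] assms[of w]
      by (simp add: matrix_vector_right_distrib cinner_add_left cinner_add_right add.commute)
    \<comment> \<open>Expanding the form at \<open>v + \<i>w\<close> gives the difference of the two cross terms.\<close>
    moreover have "- (\<i> * cinner (M *v v) w) + \<i> * cinner (M *v w) v = 0"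
      using assms[of "v + \<i> *s w"] assms[of v] assms[of w]
      by (simp add: matrix_vector_right_distrib cinner_add_left cinner_add_right
          vector_scalar_commute cinner_scale_left cinner_scale_right)
    then have "cinner (M *v w) v = cinner (M *v v) w"
      by simp
    ultimately show ?thesis
      by simp
  qed
  then have "M *v v = 0" for v
    by (metis cinner_axis_right vec_eq_iff zero_index)
  then show ?thesis
    by (simp add: matrix_eq)
qed

lemma cinner_column: "cinner v (column i F) = (conj_transpose F *v v) $ i"
  by (simp add: cinner_def column_def matrix_vector_mult_def mult.commute)

lemma sum_cinner_columns:
  "(\<Sum>i\<in>UNIV. (cmod (cinner v (column i F)))\<^sup>2) = (norm (conj_transpose F *v v))\<^sup>2"
  by (simp add: cinner_column norm_vec_def L2_set_def sum_nonneg)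

lemma gram_map_diag: "gram_map F $ i $ i = of_real ((norm (column i F))\<^sup>2)"
  unfolding cinner_self[symmetric]
  by (simp add: gram_map_def cinner_def column_def matrix_matrix_mult_def mult.commute)

lemma gram_map_diag_eq_1_iff: "gram_map F $ i $ i = 1 \<longleftrightarrow> norm (column i F) = 1"
  unfolding gram_map_diag of_real_eq_1_iff by (simp add: power2_eq_1_iff) (smt (verit) norm_ge_zero)

text \<open>Both sides of the frame identity are Hermitian forms in \<open>v\<close>, so the identity is one of matrices.\<close>

lemma tight_iff:
  fixes F :: "complex ^ 'k ^ 'n"
  shows "(\<forall>v. (\<Sum>i\<in>UNIV. (cmod (cinner v (column i F)))\<^sup>2) = B * (norm v)\<^sup>2)
    \<longleftrightarrow> F ** conj_transpose F = B *\<^sub>R mat 1"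
proof -
  let ?M = "F ** conj_transpose F - B *\<^sub>R mat 1"
  have *: "cinner (?M *v v) v =
      of_real ((\<Sum>i\<in>UNIV. (cmod (cinner v (column i F)))\<^sup>2) - B * (norm v)\<^sup>2)" for v
  proof -
    have B: "(B *\<^sub>R (mat 1 :: complex ^ 'n ^ 'n)) *v v = of_real B *s v"
      unfolding scaleR_mat_1
      by (simp add: vec_eq_iff matrix_vector_mult_def mat_def if_distrib if_distribR cong: if_cong)
    have "cinner (?M *v v) v = cinner ((F ** conj_transpose F) *v v) v
        - cinner (of_real B *s v) v"
      by (simp add: matrix_vector_mult_diff_rdistrib B cinner_diff_left)
    also have "cinner ((F ** conj_transpose F) *v v) v
        = of_real ((norm (conj_transpose F *v v))\<^sup>2)"
      by (metis cinner_adjoint cinner_self matrix_vector_mul_assoc)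
    also have "cinner (of_real B *s v) v = of_real (B * (norm v)\<^sup>2)"
      by (simp add: cinner_scale_left cinner_self)
    finally show ?thesis
      by (simp add: sum_cinner_columns)
  qed
  show ?thesis
  proof
    assume "\<forall>v. (\<Sum>i\<in>UNIV. (cmod (cinner v (column i F)))\<^sup>2) = B * (norm v)\<^sup>2"
    then have "?M = 0"
      by (intro quadratic_form_zero_imp_zero) (simp only: *, simp)
    then show "F ** conj_transpose F = B *\<^sub>R mat 1"
      by simp
  next
    assume "F ** conj_transpose F = B *\<^sub>R mat 1"
    then have "of_real ((\<Sum>i\<in>UNIV. (cmod (cinner v (column i F)))\<^sup>2) - B * (norm v)\<^sup>2) = (0::complex)" for v
      unfolding *[symmetric] by (simp add: cinner_def)
    then show "\<forall>v. (\<Sum>i\<in>UNIV. (cmod (cinner v (column i F)))\<^sup>2) = B * (norm v)\<^sup>2"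
      unfolding of_real_eq_0_iff by simp
  qed
qed

lemma spherical_tight_frame_iff:
  fixes F :: "complex ^ 'k ^ 'n"
  shows "F \<in> spherical_tight_frames \<longleftrightarrow> (\<forall>i. gram_map F $ i $ i = 1) \<and>
    F ** conj_transpose F = (real CARD('k) / real CARD('n)) *\<^sub>R mat 1"
proof -
  have B: "B = real CARD('k) / real CARD('n)"
    if "\<forall>i. gram_map F $ i $ i = 1" "F ** conj_transpose F = B *\<^sub>R mat 1" for B
  proof -
    \<comment> \<open>The bound is determined by the trace of \<open>F F\<^sup>*\<close>, which is that of \<open>F\<^sup>* F\<close>.\<close>
    have "of_real (B * real CARD('n)) = trace (B *\<^sub>R mat 1 :: complex ^ 'n ^ 'n)"
      unfolding scaleR_mat_1 by (simp add: trace_def mat_def mult.commute)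
    also have "\<dots> = trace (gram_map F)"
      using that(2) by (simp add: gram_map_def trace_mul_sym)
    also have "\<dots> = of_real (real CARD('k))"
      using that(1) by (simp add: trace_def)
    finally have "B * real CARD('n) = real CARD('k)"
      unfolding of_real_eq_iff .
    then show ?thesis
      by (simp add: field_simps)
  qed
  have "real CARD('k) / real CARD('n) > 0"
    by simp
  then show ?thesis
    unfolding spherical_tight_frames_def mem_Collect_eq tight_iff gram_map_diag_eq_1_iff[symmetric]
    using B by blast
qed

section \<open>Connectedness of the unitary group\<close>

text \<open>
  The unitary group, defined by the one-sided condition \<open>U\<^sup>* U = I\<close>; for square matrices the other
  side follows (\<open>unitaries_iff_right\<close>).
\<close>

definition unitaries :: "(complex ^ 'n ^ 'n) set"
  where "unitaries = {U. conj_transpose U ** U = mat 1}"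

lemma unitaries_iff_right: "U \<in> unitaries \<longleftrightarrow> U ** conj_transpose U = mat 1"
  unfolding unitaries_def mem_Collect_eq by (rule matrix_left_right_inverse)

lemma unitary_norm:
  assumes "U \<in> unitaries"
  shows "norm (U *v v) = norm v"
proof -
  have "cinner (U *v v) (U *v v) = cinner v v"
    using assms by (simp add: cinner_adjoint matrix_vector_mul_assoc unitaries_def)
  then have "(norm (U *v v))\<^sup>2 = (norm v)\<^sup>2"
    unfolding cinner_self of_real_eq_iff .
  then show ?thesis
    by simp
qed

lemma matrix_vector_mult_axis: "A *v axis l 1 = column l (A :: 'a::comm_semiring_1 ^ 'n ^ 'm)"
  by (simp add: vec_eq_iff matrix_vector_mult_def axis_def column_def if_distrib cong: if_cong)

text \<open>The determinant is a polynomial in \<open>z\<close> with constant coefficient 1.\<close>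

lemma finite_roots_det_pencil:
  fixes U :: "complex ^ 'n ^ 'n"
  shows "finite {z. det (mat 1 + mat z ** U) = 0}"
proof -
  define p :: "complex poly" where "p = (\<Sum>\<sigma> | \<sigma> permutes (UNIV :: 'n set).
      of_int (sign \<sigma>) * (\<Prod>i\<in>UNIV. [:mat 1 $ i $ \<sigma> i, U $ i $ \<sigma> i:]))"
  have p: "poly p z = det (mat 1 + mat z ** U)" for z
    by (simp add: p_def det_def poly_sum poly_prod mat_mult_nth)
  have "poly p 0 = 1"
    unfolding p by simp
  then have "p \<noteq> 0"
    by auto
  then show ?thesis
    using poly_roots_finite[of p] by (simp add: p)
qed

lemma continuous_on_det:
  fixes f :: "_ \<Rightarrow> 'a::real_normed_field ^ 'n ^ 'n"
  assumes "continuous_on S f"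
  shows "continuous_on S (\<lambda>x. det (f x))"
  unfolding det_def using assms by (intro continuous_intros)

lemma matrix_inv_inverse:
  fixes A :: "'a::field ^ 'n ^ 'n"
  assumes "det A \<noteq> 0"
  shows "A ** matrix_inv A = mat 1" "matrix_inv A ** A = mat 1"
  using someI_ex[of "\<lambda>A'. A ** A' = mat 1 \<and> A' ** A = mat 1"] assms
  unfolding invertible_det_nz[symmetric] invertible_def matrix_inv_def by auto

text \<open>Cramer's rule expresses the entries of the inverse as quotients of determinants.\<close>

lemma continuous_on_matrix_inv:
  fixes f :: "_ \<Rightarrow> 'a::real_normed_field ^ 'n ^ 'n"
  assumes "continuous_on S f" "\<And>x. x \<in> S \<Longrightarrow> det (f x) \<noteq> 0"
  shows "continuous_on S (\<lambda>x. matrix_inv (f x))"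
proof -
  define g where "g = (\<lambda>x. (\<chi> k l. det (\<chi> i j. if j = k then axis l 1 $ i else f x $ i $ j) / det (f x))
      :: 'a ^ 'n ^ 'n)"
  have "matrix_inv (f x) = g x" if "x \<in> S" for x
  proof -
    have "f x *v column l (matrix_inv (f x)) = axis l 1" for l
    proof -
      have "f x *v (matrix_inv (f x) *v axis l 1) = axis l 1"
        by (simp add: matrix_vector_mul_assoc matrix_inv_inverse assms(2) that)
      then show ?thesis
        by (simp only: matrix_vector_mult_axis)
    qed
    then have "column l (matrix_inv (f x))
        = (\<chi> k. det (\<chi> i j. if j = k then axis l 1 $ i else f x $ i $ j) / det (f x))" for l
      using cramer[of "f x" "column l (matrix_inv (f x))" "axis l 1"] assms(2)[OF that] by blast
    then show ?thesis
      by (simp add: vec_eq_iff g_def column_def)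
  qed
  moreover have "continuous_on S g"
  proof -
    have "continuous_on S (\<lambda>x. if j = k then axis l 1 $ i else f x $ i $ j)" for i j k l
      using assms(1) by (cases "j = k") (auto intro!: continuous_intros)
    then show ?thesis
      unfolding g_def using assms by (intro continuous_intros continuous_on_det) auto
  qed
  ultimately show ?thesis
    using continuous_on_cong by force
qed

text \<open>
  The determinant condition says that \<open>- 1\<close> is not an eigenvalue of \<open>W\<close>. The path is
  \<open>U s = N s (D s)\<^sup>-\<^sup>1\<close> with \<open>N s = s I + W\<close> and \<open>D s = I + s W\<close>; it is unitary because
  \<open>(N s)\<^sup>* N s = (D s)\<^sup>* D s\<close>.
\<close>

lemma unitary_connected_to_1:
  fixes W :: "complex ^ 'n ^ 'n"
  assumes W: "W \<in> unitaries" and det: "det (mat 1 + W) \<noteq> 0"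
  shows "connected_component unitaries W (mat 1)"
proof -
  define D where "D s = mat 1 + s *\<^sub>R W" for s :: real
  define N where "N s = s *\<^sub>R mat 1 + W" for s :: real
  define U where "U s = N s ** matrix_inv (D s)" for s
  have D_det: "det (D s) \<noteq> 0" if "s \<in> {0..1}" for s
  proof (cases "s = 1")
    case True
    with det show ?thesis by (simp add: D_def)
  next
    case False
    \<comment> \<open>For \<open>s < 1\<close>, a kernel vector has \<open>norm v = s * norm v\<close> because \<open>W\<close> is isometric.\<close>
    have "v = 0" if v: "D s *v v = 0" for v
    proof -
      have "D s *v v = v + s *\<^sub>R (W *v v)"
        unfolding D_def matrix_vector_mult_add_rdistrib matrix_vector_mul_lid
        by (simp add: vec_eq_iff matrix_vector_mult_def scaleR_sum_right)
      with v have "norm v = norm (s *\<^sub>R (W *v v))"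
        by (metis add_eq_0_iff norm_minus_cancel)
      also have "\<dots> = s * norm v"
        using \<open>s \<in> {0..1}\<close> by (simp add: unitary_norm[OF W])
      finally show "v = 0"
        using False by simp
    qed
    then show ?thesis
      unfolding invertible_det_nz[symmetric] invertible_left_inverse matrix_left_invertible_ker
      by blast
  qed
  have W1: "conj_transpose W ** W = mat 1"
    using W by (simp add: unitaries_def)
  have ND: "conj_transpose (N s) ** N s = conj_transpose (D s) ** D s" for s
    by (simp add: N_def D_def conj_transpose_add conj_transpose_scaleR matrix_add_ldistrib
        matrix_add_rdistrib matrix_scalar_ac scalar_matrix_assoc[symmetric] W1 scaleR_add_right add_ac)
  have "U s \<in> unitaries" if s: "s \<in> {0..1}" for s
  proof -
    let ?X = "matrix_inv (D s)"
    have "conj_transpose (U s) ** U s = conj_transpose ?X ** (conj_transpose (N s) ** N s) ** ?X"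
      by (simp add: U_def conj_transpose_mult matrix_mul_assoc)
    also have "\<dots> = conj_transpose (D s ** ?X) ** (D s ** ?X)"
      by (simp add: ND conj_transpose_mult matrix_mul_assoc)
    finally show ?thesis
      by (simp add: matrix_inv_inverse D_det[OF s] unitaries_def)
  qed
  moreover have "continuous_on {0..1} U"
  proof -
    have "continuous_on {0..1} D" "continuous_on {0..1} N"
      unfolding D_def N_def by (intro continuous_intros)+
    then show ?thesis
      unfolding U_def using D_det by (intro continuous_intros continuous_on_matrix_inv) auto
  qed
  then have "connected (U ` {0..1})"
    by (intro connected_continuous_image) auto
  moreover have "U 0 = W"
    using matrix_inv_inverse[of "mat 1 :: complex ^ 'n ^ 'n"] by (simp add: U_def N_def D_def)
  moreover have "U 1 = mat 1"
    using matrix_inv_inverse[OF D_det[of 1]] by (simp add: U_def N_def D_def)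
  ultimately show ?thesis
    unfolding connected_component_def
    by (intro exI[of _ "U ` {0..1}"] conjI) (auto intro: rev_image_eqI[of 0] rev_image_eqI[of 1])
qed

lemma connected_unitaries: "connected (unitaries :: (complex ^ 'n ^ 'n) set)"
proof -
  have "connected_component unitaries U (mat 1)" if U: "U \<in> unitaries"
    for U :: "complex ^ 'n ^ 'n"
  proof -
    have conn: "connected (sphere 0 1 :: complex set)"
      by (simp add: connected_sphere)
    have "(1 :: complex) \<in> sphere 0 1" "(- 1 :: complex) \<in> sphere 0 1"
      by simp_all
    then have "infinite (sphere 0 1 :: complex set)"
      using connected_finite_iff_sing[OF conn]
      by (metis empty_iff one_neq_neg_one singletonD)
    \<comment> \<open>Only finitely many scalars \<open>c\<close> are bad, but the unit circle is infinite.\<close>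
    then obtain c :: complex where c: "cmod c = 1" "det (mat 1 + mat c ** U) \<noteq> 0"
      using finite_roots_det_pencil[of U] infinite_super[of "sphere 0 1"]
      by (metis (mono_tags, lifting) mem_Collect_eq mem_sphere_0 subsetI)
    have rot: "mat z ** U \<in> unitaries" if "cmod z = 1" for z
    proof -
      have "conj_transpose (mat z ** U) ** (mat z ** U) = mat (cnj z * z) ** (conj_transpose U ** U)"
        by (simp add: vec_eq_iff mat_mult_nth matrix_matrix_mult_def[of "conj_transpose _"]
            sum_distrib_left mult_ac)
      then show ?thesis
        using U that complex_norm_square[of z] by (simp add: unitaries_def mult.commute)
    qed
    have "connected ((\<lambda>z. mat z ** U) ` sphere 0 1)"
    proof (intro connected_continuous_image)
      have "continuous_on (sphere 0 1) (\<lambda>z. \<chi> i j. z * U $ i $ j)"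
        by (intro continuous_intros)
      moreover have "mat z ** U = (\<chi> i j. z * U $ i $ j)" for z
        by (simp add: vec_eq_iff mat_mult_nth)
      ultimately show "continuous_on (sphere 0 1) (\<lambda>z. mat z ** U)"
        by simp
    qed (rule conn)
    moreover have "(\<lambda>z. mat z ** U) ` sphere 0 1 \<subseteq> unitaries"
      using rot by auto
    moreover have "U \<in> (\<lambda>z. mat z ** U) ` sphere 0 1"
      by (rule rev_image_eqI[of 1]) simp_all
    moreover have "mat c ** U \<in> (\<lambda>z. mat z ** U) ` sphere 0 1"
      using c(1) by simp
    ultimately have "connected_component unitaries U (mat c ** U)"
      unfolding connected_component_def by blast
    then show ?thesis
      using unitary_connected_to_1[OF rot[OF c(1)] c(2)] connected_component_trans by blast
  qed
  then show ?thesis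
    unfolding connected_iff_connected_component
    by (meson connected_component_sym connected_component_trans)
qed

section \<open>Projections and their rank\<close>

lemma projection_diag:
  assumes "is_projection P"
  shows "P $ a $ a = of_real (\<Sum>b\<in>UNIV. (cmod (P $ a $ b))\<^sup>2)"
proof -
  have "P $ a $ a = (P ** conj_transpose P) $ a $ a"
    using assms by (simp add: is_projection_def)
  then show ?thesis
    by (simp add: matrix_matrix_mult_def complex_norm_square del: of_real_power)
qed

lemma trace_sum: "trace (\<Sum>i\<in>I. A i) = (\<Sum>i\<in>I. trace (A i :: 'a::semiring_1 ^ 'n ^ 'n))"
  unfolding trace_def by (simp add: sum.swap[of _ I])

lemma matrix_mult_sum_right:
  fixes A :: "'a::semiring_1 ^ 'n ^ 'm"
  shows "A ** (\<Sum>i\<in>I. B i) = (\<Sum>i\<in>I. A ** B i)"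
  by (simp add: vec_eq_iff matrix_matrix_mult_def sum_distrib_left sum.swap[of _ I])

text \<open>
  The spectral theorem for projections: a projection is a sum of mutually orthogonal rank one
  projections. The vectors are kept as one-row matrices \<open>w i\<close>, so that \<open>w\<^sup>* w\<close> is a rank one
  projection and \<open>w v\<^sup>*\<close> an inner product. The proof peels off a normalised nonzero row
  at a time, each step lowering the trace by 1; the trace is nonnegative, so this ends.
\<close>

lemma projection_decomposition:
  fixes P :: "complex ^ 'k ^ 'k"
  assumes "is_projection P"
  shows "\<exists>m (w :: nat \<Rightarrow> complex ^ 'k ^ 1).
    P = (\<Sum>i<m. conj_transpose (w i) ** w i) \<and>
    (\<forall>i<m. \<forall>j<m. w i ** conj_transpose (w j) = (if i = j then mat 1 else 0))"
proof -
  have "Re (trace P) \<le> of_nat N \<Longrightarrow> ?thesis" for N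
    using assms
  proof (induction N arbitrary: P)
    case (0 P)
    \<comment> \<open>The trace of a projection is the sum of the squared moduli of its entries.\<close>
    have "(\<Sum>a\<in>UNIV. \<Sum>b\<in>UNIV. (cmod (P $ a $ b))\<^sup>2) \<le> 0"
      using 0 by (simp add: trace_def projection_diag)
    moreover have "(\<Sum>a\<in>UNIV. \<Sum>b\<in>UNIV. (cmod (P $ a $ b))\<^sup>2) \<ge> 0"
      by (intro sum_nonneg) auto
    ultimately have "P = 0"
      by (simp add: sum_nonneg_eq_0_iff sum_nonneg vec_eq_iff order.antisym)
    then show ?case
      by (intro exI[of _ 0]) simp
  next
    case (Suc N P)
    show ?case
    proof (cases "P = 0")
      case True
      then show ?thesis
        by (intro exI[of _ 0]) simp
    next
      case False
      then obtain a b where ab: "P $ a $ b \<noteq> 0"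
        by (auto simp: vec_eq_iff)
      have P: "conj_transpose P = P" "P ** P = P"
        using Suc.prems by (simp_all add: is_projection_def)
      define d where "d = (\<Sum>b\<in>UNIV. (cmod (P $ a $ b))\<^sup>2)"
      have "d > 0"
        unfolding d_def using ab by (intro sum_pos2[of _ b]) auto
      define w :: "complex ^ 'k ^ 1" where "w = (\<chi> _ b. P $ a $ b / of_real (sqrt d))"
      have wP: "w ** P = w"
      proof -
        have "(\<Sum>l\<in>UNIV. P $ a $ l * P $ l $ j) = P $ a $ j" for j
          using arg_cong[OF P(2), of "\<lambda>A. A $ a $ j"] by (simp add: matrix_matrix_mult_def)
        then show ?thesis
          by (simp add: vec_eq_iff w_def matrix_matrix_mult_def flip: sum_divide_distrib)
      qed
      have Pw: "P ** conj_transpose w = conj_transpose w"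
        using arg_cong[OF wP, of conj_transpose] by (simp add: conj_transpose_mult P)
      have ww: "w ** conj_transpose w = mat 1"
      proof -
        have "(\<Sum>b\<in>UNIV. P $ a $ b * cnj (P $ a $ b)) = of_real d"
          by (simp add: d_def complex_norm_square del: of_real_power)
        moreover have "complex_of_real (sqrt d) * complex_of_real (sqrt d) = of_real d"
          using \<open>d > 0\<close> by (simp flip: of_real_mult)
        ultimately show ?thesis
          using \<open>d > 0\<close>
          by (simp add: vec_eq_iff w_def matrix_matrix_mult_def mat_def flip: sum_divide_distrib)
      qed
      define Q where "Q = P - conj_transpose w ** w"
      have Qw: "Q ** conj_transpose w = 0"
        by (simp add: Q_def matrix_diff_rdistrib Pw ww flip: matrix_mul_assoc)
      have Qproj: "is_projection Q"
      proof -
        have "conj_transpose Q = Q"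
          by (simp add: Q_def conj_transpose_diff conj_transpose_mult P)
        moreover have "Q ** Q = Q ** P - Q ** conj_transpose w ** w"
          by (simp add: Q_def matrix_diff_ldistrib matrix_mul_assoc)
        then have "Q ** Q = Q"
          by (simp add: Qw) (simp add: Q_def matrix_diff_rdistrib P wP flip: matrix_mul_assoc)
        ultimately show ?thesis
          by (simp add: is_projection_def)
      qed
      have "trace Q = trace P - 1"
        by (simp add: Q_def trace_sub trace_mul_sym[of "conj_transpose w"] ww trace_I)
      then have "Re (trace Q) \<le> of_nat N"
        using Suc.prems(1) by simp
      from Suc.IH[OF this Qproj] obtain m and u :: "nat \<Rightarrow> complex ^ 'k ^ 1"
        where u: "Q = (\<Sum>i<m. conj_transpose (u i) ** u i)"
          "\<And>i j. i < m \<Longrightarrow> j < m \<Longrightarrow> u i ** conj_transpose (u j) = (if i = j then mat 1 else 0)"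
        by blast
      have uw: "u i ** conj_transpose w = 0" if "i < m" for i
      proof -
        have "u i ** Q = (\<Sum>j<m. u i ** conj_transpose (u j) ** u j)"
          by (simp add: u(1) matrix_mult_sum_right matrix_mul_assoc)
        also have "\<dots> = (\<Sum>j<m. if j = i then u i else 0)"
          by (intro sum.cong) (auto simp: u(2) that)
        also have "\<dots> = u i"
          using that by simp
        finally show ?thesis
          by (metis Qw matrix_mul_assoc matrix_mult_zero_right)
      qed
      then have wu: "w ** conj_transpose (u i) = 0" if "i < m" for i
        using arg_cong[OF uw[OF that], of conj_transpose] by (simp add: conj_transpose_mult)
      have "P = (\<Sum>i<Suc m. conj_transpose ((u(m := w)) i) ** (u(m := w)) i)"
        using u(1) by (simp add: Q_def diff_eq_eq)
      moreover have "\<forall>i<Suc m. \<forall>j<Suc m. (u(m := w)) i ** conj_transpose ((u(m := w)) j)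
          = (if i = j then mat 1 else 0)"
        by (auto simp: less_Suc_eq u(2) uw wu ww)
      ultimately show ?thesis
        by blast
    qed
  qed
  then show ?thesis
    using real_nat_ceiling_ge by blast
qed

lemma projection_decomposition_trace:
  fixes w :: "nat \<Rightarrow> complex ^ 'k ^ 1"
  assumes "P = (\<Sum>i<m. conj_transpose (w i) ** w i)"
    and "\<And>i j. i < m \<Longrightarrow> j < m \<Longrightarrow> w i ** conj_transpose (w j) = (if i = j then mat 1 else 0)"
  shows "trace P = of_nat m"
  unfolding assms(1) trace_sum by (simp add: trace_mul_sym[of "conj_transpose _"] assms(2) trace_I)

lemma rank_projection:
  fixes P :: "complex ^ 'k ^ 'k"
  assumes "is_projection P"
  shows "of_nat (rank P) = trace P"
proof -
  obtain m and w :: "nat \<Rightarrow> complex ^ 'k ^ 1" where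
    P: "P = (\<Sum>i<m. conj_transpose (w i) ** w i)" and
    w: "\<And>i j. i < m \<Longrightarrow> j < m \<Longrightarrow> w i ** conj_transpose (w j) = (if i = j then mat 1 else 0)"
    using projection_decomposition[OF assms] by blast
  define b where "b i = w i $ 1" for i
  have ortho: "cinner (b i) (b j) = (if i = j then 1 else 0)" if "i < m" "j < m" for i j
    using arg_cong[OF w[OF that], of "\<lambda>A. A $ 1 $ 1"]
    by (simp add: b_def cinner_def matrix_matrix_mult_def mat_def split: if_splits)
  have inj: "inj_on b {..<m}"
    by (rule inj_onI) (metis lessThan_iff ortho zero_neq_one)
  have indep: "vec.independent (b ` {..<m})"
    unfolding vec.independent_explicit
  proof (intro conjI allI impI ballI)
    fix c v
    assume sum0: "(\<Sum>v\<in>b ` {..<m}. c v *s v) = 0" and "v \<in> b ` {..<m}"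
    then obtain j where j: "j < m" "v = b j"
      by blast
    have "0 = cinner (\<Sum>i<m. c (b i) *s b i) (b j)"
      using sum0 by (simp add: sum.reindex[OF inj] cinner_def)
    also have "\<dots> = (\<Sum>i<m. c (b i) * cinner (b i) (b j))"
      by (simp add: cinner_sum_left cinner_scale_left)
    also have "\<dots> = (\<Sum>i<m. if i = j then c v else 0)"
      by (intro sum.cong) (auto simp: ortho j)
    finally show "c v = 0"
      using j by simp
  qed simp
  have "P $ a = (\<Sum>i<m. cnj (b i $ a) *s b i)" for a
    by (simp add: P vec_eq_iff b_def matrix_matrix_mult_def)
  then have "P $ a \<in> vec.span (b ` {..<m})" for a
    by (simp only:) (intro vec.span_sum vec.span_scale vec.span_base imageI)
  then have "rows P \<subseteq> vec.span (b ` {..<m})"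
    by (auto simp: rows_def row_def)
  moreover have "b i \<in> vec.span (rows P)" if "i < m" for i
  proof -
    have "w i ** P = (\<Sum>j<m. w i ** conj_transpose (w j) ** w j)"
      by (simp add: P matrix_mult_sum_right matrix_mul_assoc)
    also have "\<dots> = (\<Sum>j<m. if j = i then w i else 0)"
      by (intro sum.cong) (auto simp: w that)
    also have "\<dots> = w i"
      using that by simp
    finally have "b i = (w i ** P) $ 1"
      by (simp add: b_def)
    also have "\<dots> = (\<Sum>a\<in>UNIV. (w i $ 1 $ a) *s P $ a)"
      by (simp add: vec_eq_iff matrix_matrix_mult_def)
    also have "\<dots> \<in> vec.span (rows P)"
      by (intro vec.span_sum vec.span_scale vec.span_base) (auto simp: rows_def row_def)
    finally show ?thesis .
  qed
  ultimately have "vec.span (b ` {..<m}) = vec.span (rows P)"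
    by (intro vec.span_eq[THEN iffD2]) auto
  then have "rank P = card (b ` {..<m})"
    unfolding row_rank_def_gen using indep by (rule vec.dim_eq_card)
  then show ?thesis
    using projection_decomposition_trace[OF P w] by (simp add: card_image inj)
qed

text \<open>The diagonal condition fixes the trace to be \<open>n\<close>, hence makes the rank condition redundant.\<close>

lemma frame_grams_eq:
  assumes "n > 0"
  shows "frame_grams n = {(real CARD('k) / real n) *\<^sub>R P | P :: complex ^ 'k ^ 'k.
      is_projection P \<and> (\<forall>i. P $ i $ i = of_real (real n / real CARD('k)))}"
proof -
  have "rank P = n" if "is_projection P" "\<forall>i. P $ i $ i = of_real (real n / real CARD('k))"
    for P :: "complex ^ 'k ^ 'k"
  proof -
    have "of_nat (rank P) = (of_nat n :: complex)"
      using that by (simp add: rank_projection trace_def)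
    then show ?thesis
      unfolding of_nat_eq_iff .
  qed
  then show ?thesis
    unfolding frame_grams_def by blast
qed

section \<open>The Gram map: image, fibres and closedness\<close>

text \<open>
  For the inclusion from right to left, the rows of the frame are the orthonormal vectors into which
  the projection decomposes, scaled by the square root of \<open>k / n\<close>.
\<close>

lemma gram_map_image:
  "gram_map ` (spherical_tight_frames :: (complex ^ 'k ^ 'n) set)
    = (frame_grams CARD('n) :: (complex ^ 'k ^ 'k) set)"
proof (intro equalityI subsetI)
  let ?B = "real CARD('k) / real CARD('n)"
  fix G :: "complex ^ 'k ^ 'k"
  assume "G \<in> gram_map ` (spherical_tight_frames :: (complex ^ 'k ^ 'n) set)"
  then obtain F :: "complex ^ 'k ^ 'n" where G: "G = conj_transpose F ** F"
    and F: "\<And>i. G $ i $ i = 1" "F ** conj_transpose F = ?B *\<^sub>R mat 1"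
    by (auto simp: spherical_tight_frame_iff gram_map_def)
  define P where "P = inverse ?B *\<^sub>R G"
  have "G ** G = conj_transpose F ** (F ** conj_transpose F) ** F"
    by (simp add: G matrix_mul_assoc)
  then have "G ** G = ?B *\<^sub>R G"
    unfolding F(2) by (simp add: matrix_scalar_ac G flip: scalar_matrix_assoc)
  then have "is_projection P"
    by (simp add: is_projection_def P_def conj_transpose_scaleR matrix_scalar_ac
        flip: scalar_matrix_assoc) (simp add: G conj_transpose_mult)
  moreover have "P $ i $ i = of_real (real CARD('n) / real CARD('k))" for i
    by (simp add: P_def F(1) scaleR_conv_of_real[where 'a = complex])
  moreover have "G = ?B *\<^sub>R P"
    by (simp add: P_def)
  ultimately show "G \<in> frame_grams CARD('n)"
    by (auto simp: frame_grams_eq)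
next
  let ?B = "real CARD('k) / real CARD('n)"
  fix G :: "complex ^ 'k ^ 'k"
  assume "G \<in> frame_grams CARD('n)"
  then obtain P where G: "G = ?B *\<^sub>R P" and proj: "is_projection P"
    and diag: "\<And>i. P $ i $ i = of_real (real CARD('n) / real CARD('k))"
    by (auto simp: frame_grams_eq)
  obtain m and w :: "nat \<Rightarrow> complex ^ 'k ^ 1" where
    P: "P = (\<Sum>i<m. conj_transpose (w i) ** w i)" and
    w: "\<And>i j. i < m \<Longrightarrow> j < m \<Longrightarrow> w i ** conj_transpose (w j) = (if i = j then mat 1 else 0)"
    using projection_decomposition[OF proj] by blast
  have "of_nat m = (of_nat CARD('n) :: complex)"
    using projection_decomposition_trace[OF P w] by (simp add: trace_def diag)
  then have m: "m = CARD('n)"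
    unfolding of_nat_eq_iff .
  obtain h where h: "bij_betw h (UNIV :: 'n set) {..<m}"
    using ex_bij_betw_finite_nat[of "UNIV :: 'n set"] by (auto simp: m atLeast0LessThan)
  then have hm: "h a < m" and h_inj: "h a = h b \<longleftrightarrow> a = b" for a b
    by (auto simp: bij_betw_def inj_on_def)
  define E :: "complex ^ 'k ^ 'n" where "E = (\<chi> a j. w (h a) $ 1 $ j)"
  have EE: "E ** conj_transpose E = mat 1"
  proof -
    have "(E ** conj_transpose E) $ a $ b = (w (h a) ** conj_transpose (w (h b))) $ 1 $ 1" for a b
      by (simp add: E_def matrix_matrix_mult_def)
    then show ?thesis
      by (simp add: vec_eq_iff w hm h_inj mat_def)
  qed
  have EP: "conj_transpose E ** E = P"
  proof -
    have "(conj_transpose E ** E) $ i $ j = P $ i $ j" for i j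
    proof -
      have "(conj_transpose E ** E) $ i $ j = (\<Sum>a\<in>UNIV. cnj (w (h a) $ 1 $ i) * w (h a) $ 1 $ j)"
        by (simp add: E_def matrix_matrix_mult_def)
      also have "\<dots> = (\<Sum>l<m. cnj (w l $ 1 $ i) * w l $ 1 $ j)"
        using h by (rule sum.reindex_bij_betw)
      finally show ?thesis
        by (simp add: P matrix_matrix_mult_def)
    qed
    then show ?thesis
      by (simp add: vec_eq_iff)
  qed
  \<comment> \<open>The rows of \<open>E\<close> are orthonormal; rescaling gives the frame bound \<open>k / n\<close>.\<close>
  define F where "F = sqrt ?B *\<^sub>R E"
  have "gram_map F = G"
    by (simp add: gram_map_def F_def conj_transpose_scaleR matrix_scalar_ac EP G
        flip: scalar_matrix_assoc)
  moreover have "F ** conj_transpose F = ?B *\<^sub>R mat 1"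
    by (simp add: F_def conj_transpose_scaleR matrix_scalar_ac EE flip: scalar_matrix_assoc)
  moreover have "G $ i $ i = 1" for i
    by (simp add: G diag scaleR_conv_of_real[where 'a = complex])
  ultimately show "G \<in> gram_map ` (spherical_tight_frames :: (complex ^ 'k ^ 'n) set)"
    by (auto simp: spherical_tight_frame_iff)
qed

text \<open>A nonempty fibre is the orbit of any of its points under the unitary group.\<close>

lemma connected_gram_map_fibre:
  "connected ((spherical_tight_frames :: (complex ^ 'k ^ 'n) set) \<inter> gram_map -` {G})"
proof (cases "(spherical_tight_frames :: (complex ^ 'k ^ 'n) set) \<inter> gram_map -` {G} = {}")
  case True
  then show ?thesis by simp
next
  case False
  let ?B = "real CARD('k) / real CARD('n)"
  let ?S = "(spherical_tight_frames :: (complex ^ 'k ^ 'n) set) \<inter> gram_map -` {G}"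
  obtain F where F: "F \<in> ?S"
    using False by blast
  then have FF: "F ** conj_transpose F = ?B *\<^sub>R mat 1"
    by (simp add: spherical_tight_frame_iff)
  have "?S = (\<lambda>U. U ** F) ` unitaries"
  proof (intro equalityI subsetI)
    fix H assume H: "H \<in> ?S"
    have HH: "H ** conj_transpose H = ?B *\<^sub>R mat 1"
      using H by (simp add: spherical_tight_frame_iff)
    have HF: "conj_transpose H ** H = conj_transpose F ** F"
      using H F by (simp add: gram_map_def)
    \<comment> \<open>The only candidate: \<open>H = U F\<close> and \<open>F F\<^sup>* = (k/n) I\<close> force \<open>H F\<^sup>* = (k/n) U\<close>.\<close>
    define U where "U = inverse ?B *\<^sub>R (H ** conj_transpose F)"
    have "U ** F = inverse ?B *\<^sub>R (H ** (conj_transpose F ** F))"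
      by (simp add: U_def matrix_mul_assoc flip: scalar_matrix_assoc)
    also have "\<dots> = inverse ?B *\<^sub>R (H ** conj_transpose H ** H)"
      by (simp add: HF flip: matrix_mul_assoc)
    also have "\<dots> = H"
      unfolding HH by (simp flip: scalar_matrix_assoc)
    finally have UF: "U ** F = H" .
    have "U ** conj_transpose U = inverse ?B *\<^sub>R (U ** F ** conj_transpose H)"
      by (simp add: U_def conj_transpose_scaleR conj_transpose_mult matrix_scalar_ac
          matrix_mul_assoc flip: scalar_matrix_assoc)
    then have "U \<in> unitaries"
      unfolding UF HH unitaries_iff_right by simp
    then show "H \<in> (\<lambda>U. U ** F) ` unitaries"
      using UF by blast
  next
    fix H assume "H \<in> (\<lambda>U. U ** F) ` unitaries"
    then obtain U where U: "U \<in> unitaries" and H: "H = U ** F"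
      by blast
    have "conj_transpose H ** H = conj_transpose F ** (conj_transpose U ** U) ** F"
      by (simp add: H conj_transpose_mult matrix_mul_assoc)
    then have g: "gram_map H = gram_map F"
      using U by (simp add: unitaries_def gram_map_def)
    have "H ** conj_transpose H = U ** (F ** conj_transpose F) ** conj_transpose U"
      by (simp add: H conj_transpose_mult matrix_mul_assoc)
    also have "\<dots> = ?B *\<^sub>R (U ** conj_transpose U)"
      unfolding FF by (simp add: matrix_scalar_ac flip: scalar_matrix_assoc)
    finally have "H ** conj_transpose H = ?B *\<^sub>R mat 1"
      using U by (simp add: unitaries_iff_right)
    then show "H \<in> ?S"
      using F g by (auto simp: spherical_tight_frame_iff)
  qed
  moreover have "connected ((\<lambda>U. U ** F) ` unitaries)"
    by (intro connected_continuous_image connected_unitaries continuous_intros)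
  ultimately show ?thesis
    by simp
qed

lemma continuous_on_gram_map: "continuous_on S gram_map"
  unfolding gram_map_def by (intro continuous_intros)

lemma compact_spherical_tight_frames: "compact (spherical_tight_frames :: (complex ^ 'k ^ 'n) set)"
proof -
  let ?S = "spherical_tight_frames :: (complex ^ 'k ^ 'n) set"
  have "?S = (\<Inter>i. {F. gram_map F $ i $ i = 1}) \<inter>
      {F. F ** conj_transpose F = (real CARD('k) / real CARD('n)) *\<^sub>R mat 1}"
    by (auto simp: spherical_tight_frame_iff)
  moreover have "closed \<dots>"
    by (intro closed_Int closed_INT closed_Collect_eq ballI continuous_intros continuous_on_gram_map)
  ultimately have "closed ?S"
    by simp
  moreover have "norm F \<le> (\<Sum>a\<in>(UNIV::'n set). \<Sum>i\<in>(UNIV::'k set). 1)" if "F \<in> ?S" for F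
  proof -
    have "cmod (F $ a $ i) \<le> 1" for a i
    proof -
      have "cmod (column i F $ a) \<le> norm (column i F)"
        by (rule Finite_Cartesian_Product.norm_nth_le)
      then show ?thesis
        using that by (simp add: spherical_tight_frames_def column_def)
    qed
    then have "(\<Sum>i\<in>UNIV. cmod (F $ a $ i)) \<le> (\<Sum>i\<in>(UNIV::'k set). 1)" for a
      by (intro sum_mono)
    moreover have "norm (F $ a) \<le> (\<Sum>i\<in>UNIV. cmod (F $ a $ i))" for a
      by (simp add: norm_vec_def L2_set_le_sum)
    ultimately have "norm (F $ a) \<le> (\<Sum>i\<in>(UNIV::'k set). 1)" for a
      by (rule order_trans[rotated])
    then have "(\<Sum>a\<in>UNIV. norm (F $ a)) \<le> (\<Sum>a\<in>(UNIV::'n set). \<Sum>i\<in>(UNIV::'k set). 1)"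
      by (intro sum_mono)
    moreover have "norm F \<le> (\<Sum>a\<in>UNIV. norm (F $ a))"
      by (simp add: norm_vec_def[of F] L2_set_le_sum)
    ultimately show ?thesis
      by linarith
  qed
  then have "bounded ?S"
    unfolding bounded_iff by blast
  ultimately show ?thesis
    by (simp add: compact_eq_bounded_closed)
qed

text \<open>
  By compactness the Gram map is closed, and closed maps with connected fibres pull connected sets
  back to connected sets.
\<close>

lemma connected_gram_map_preimage:
  assumes "connected C" "C \<subseteq> frame_grams CARD('n)"
  shows "connected ((spherical_tight_frames :: (complex ^ 'k ^ 'n) set) \<inter> gram_map -` C)"
  by (rule connected_closed_monotone_preimage[OF continuous_on_gram_map gram_map_image
        Abstract_Topology_2.continuous_imp_closed_map[OF _ continuous_on_gram_map gram_map_image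
          compact_spherical_tight_frames] connected_gram_map_fibre assms])

section \<open>Components and complementary projections\<close>

text \<open>The bijection sends a component of the target to its preimage.\<close>

lemma components_eqpoll_of_connected_preimages:
  assumes contf: "continuous_on S f" and fim: "f ` S = T"
    and pre: "\<And>C. connected C \<Longrightarrow> C \<subseteq> T \<Longrightarrow> connected (S \<inter> f -` C)"
  shows "components S \<approx> components T"
proof -
  have "S \<inter> f -` C \<in> components S" if C: "C \<in> components T" for C
  proof -
    have C': "C \<noteq> {}" "C \<subseteq> T" "connected C"
      using C in_components_nonempty in_components_subset in_components_connected by blast+
    show ?thesis
      unfolding in_components_maximal
    proof (intro conjI allI impI)
      show "S \<inter> f -` C \<noteq> {}" "S \<inter> f -` C \<subseteq> S" "connected (S \<inter> f -` C)"
        using C' fim pre by blast+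
      fix D assume D: "D \<noteq> {} \<and> S \<inter> f -` C \<subseteq> D \<and> D \<subseteq> S \<and> connected D"
      have "connected (f ` D)"
        using D contf by (meson connected_continuous_image continuous_on_subset)
      moreover have "C \<subseteq> f ` D"
        using D C' fim by blast
      moreover have "f ` D \<subseteq> T"
        using D fim by blast
      moreover have "f ` D \<noteq> {}"
        using D by simp
      ultimately have "f ` D = C"
        using C by (simp add: in_components_maximal)
      then show "D = S \<inter> f -` C"
        using D by blast
    qed
  qed
  moreover have "inj_on (\<lambda>C. S \<inter> f -` C) (components T)"
  proof (rule inj_onI)
    fix C D assume "C \<in> components T" "D \<in> components T" and eq: "S \<inter> f -` C = S \<inter> f -` D"
    then have "C \<subseteq> T" "D \<subseteq> T"
      using in_components_subset by blast+
    then have "C = f ` (S \<inter> f -` C)" "D = f ` (S \<inter> f -` D)"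
      using fim by blast+
    then show "C = D"
      using eq by simp
  qed
  moreover have "D \<in> (\<lambda>C. S \<inter> f -` C) ` components T" if D: "D \<in> components S" for D
  proof -
    have D': "D \<noteq> {}" "D \<subseteq> S" "connected D"
      using D in_components_nonempty in_components_subset in_components_connected by blast+
    have "connected (f ` D)" "f ` D \<noteq> {}" "f ` D \<subseteq> T"
      using D' contf fim by (auto intro: connected_continuous_image continuous_on_subset)
    then obtain C where C: "C \<in> components T" "f ` D \<subseteq> C"
      using exists_component_superset[of "f ` D" T] by blast
    have "connected (S \<inter> f -` C)"
      using C(1) pre in_components_connected in_components_subset by blast
    moreover have "D \<subseteq> S \<inter> f -` C"
      using C(2) D'(2) by blast
    moreover from this have "S \<inter> f -` C \<noteq> {}"
      using D'(1) by blast
    ultimately have "S \<inter> f -` C = D"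
      using D by (simp add: in_components_maximal)
    then show ?thesis
      using C(1) by blast
  qed
  ultimately have "bij_betw (\<lambda>C. S \<inter> f -` C) (components T) (components S)"
    unfolding bij_betw_def by blast
  then show ?thesis
    using eqpoll_def eqpoll_sym by blast
qed

lemma connected_spherical_tight_frames_iff:
  "connected (spherical_tight_frames :: (complex ^ 'k ^ 'n) set) \<longleftrightarrow>
    connected (frame_grams CARD('n) :: (complex ^ 'k ^ 'k) set)"
proof
  assume "connected (spherical_tight_frames :: (complex ^ 'k ^ 'n) set)"
  then show "connected (frame_grams CARD('n) :: (complex ^ 'k ^ 'k) set)"
    unfolding gram_map_image[symmetric]
    by (intro connected_continuous_image continuous_on_gram_map)
next
  assume "connected (frame_grams CARD('n) :: (complex ^ 'k ^ 'k) set)"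
  then have "connected ((spherical_tight_frames :: (complex ^ 'k ^ 'n) set)
      \<inter> gram_map -` frame_grams CARD('n))"
    by (intro connected_gram_map_preimage) auto
  moreover have "(spherical_tight_frames :: (complex ^ 'k ^ 'n) set)
      \<inter> gram_map -` frame_grams CARD('n) = spherical_tight_frames"
    using gram_map_image by blast
  ultimately show "connected (spherical_tight_frames :: (complex ^ 'k ^ 'n) set)"
    by simp
qed

lemma frame_grams_complement:
  assumes "0 < m" "0 < n" "m + n = CARD('k)"
    and "connected (frame_grams n :: (complex ^ 'k ^ 'k) set)"
  shows "connected (frame_grams m :: (complex ^ 'k ^ 'k) set)"
proof -
  let ?k = "real CARD('k)"
  \<comment> \<open>\<open>(k/n) P\<close> is sent to \<open>(k/m) (I - P)\<close>.\<close>
  define \<phi> :: "complex ^ 'k ^ 'k \<Rightarrow> complex ^ 'k ^ 'k"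
    where "\<phi> X = (?k / m) *\<^sub>R (mat 1 - (n / ?k) *\<^sub>R X)" for X
  have compl: "is_projection (mat 1 - P)" if "is_projection P" for P :: "complex ^ 'k ^ 'k"
    using that by (simp add: is_projection_def conj_transpose_diff matrix_diff_ldistrib
        matrix_diff_rdistrib)
  have k: "?k = real m + real n"
    using assms(3) by linarith
  have diag_compl: "(mat 1 - P) $ i $ i = of_real (1 - r)" if "P $ i $ i = of_real r"
    for P :: "complex ^ 'k ^ 'k" and i r
    using that by (simp add: mat_def)
  have "frame_grams m = \<phi> ` frame_grams n"
  proof (intro equalityI subsetI)
    fix X :: "complex ^ 'k ^ 'k"
    assume "X \<in> frame_grams m"
    then obtain P where P: "X = (?k / m) *\<^sub>R P" "is_projection P"
      "\<forall>i. P $ i $ i = of_real (m / ?k)"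
      using assms by (auto simp: frame_grams_eq)
    have "1 - m / ?k = n / ?k"
      using assms(1) by (simp add: k field_simps)
    then have "\<forall>i. (mat 1 - P) $ i $ i = of_real (n / ?k)"
      using P(3) by (metis diag_compl)
    then have "(?k / n) *\<^sub>R (mat 1 - P) \<in> frame_grams n"
      using assms compl[OF P(2)] by (auto simp: frame_grams_eq)
    moreover have "\<phi> ((?k / n) *\<^sub>R (mat 1 - P)) = X"
      using assms by (simp add: \<phi>_def P(1))
    ultimately show "X \<in> \<phi> ` frame_grams n"
      by blast
  next
    fix X assume "X \<in> \<phi> ` frame_grams n"
    then obtain P where P: "X = \<phi> ((?k / n) *\<^sub>R P)" "is_projection P"
      "\<forall>i. P $ i $ i = of_real (n / ?k)"
      using assms by (auto simp: frame_grams_eq)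
    have "1 - n / ?k = m / ?k"
      using assms(1) by (simp add: k field_simps)
    then have "\<forall>i. (mat 1 - P) $ i $ i = of_real (m / ?k)"
      using P(3) by (metis diag_compl)
    moreover have "X = (?k / m) *\<^sub>R (mat 1 - P)"
      using assms by (simp add: \<phi>_def P(1))
    ultimately show "X \<in> frame_grams m"
      using assms compl[OF P(2)] by (auto simp: frame_grams_eq)
  qed
  moreover have "continuous_on (frame_grams n) \<phi>"
    unfolding \<phi>_def by (intro continuous_intros)
  ultimately show ?thesis
    using assms(4) by (simp add: connected_continuous_image)
qed

theorem proposition7p1:
  assumes "CARD('n::finite) < CARD('k::finite)"
  shows "(\<forall>C \<in> components (frame_grams CARD('n) :: (complex ^ 'k ^ 'k) set).
            connected {F \<in> (spherical_tight_frames :: (complex ^ 'k ^ 'n) set). gram_map F \<in> C})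
       \<and> components (spherical_tight_frames :: (complex ^ 'k ^ 'n) set)
           \<approx> components (frame_grams CARD('n) :: (complex ^ 'k ^ 'k) set)
       \<and> (connected (spherical_tight_frames :: (complex ^ 'k ^ 'n) set) \<longleftrightarrow>
            connected (frame_grams CARD('n) :: (complex ^ 'k ^ 'k) set))
       \<and> (CARD('m::finite) = CARD('k) - CARD('n) \<longrightarrow>
            (connected (spherical_tight_frames :: (complex ^ 'k ^ 'n) set) \<longleftrightarrow>
             connected (spherical_tight_frames :: (complex ^ 'k ^ 'm) set)))"
proof (intro conjI ballI impI)
  fix C assume "C \<in> components (frame_grams CARD('n) :: (complex ^ 'k ^ 'k) set)"
  then have "connected ((spherical_tight_frames :: (complex ^ 'k ^ 'n) set) \<inter> gram_map -` C)"
    using connected_gram_map_preimage in_components_connected in_components_subset by blast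
  then show "connected {F \<in> (spherical_tight_frames :: (complex ^ 'k ^ 'n) set). gram_map F \<in> C}"
    by (simp add: Int_def)
next
  show "components (spherical_tight_frames :: (complex ^ 'k ^ 'n) set)
      \<approx> components (frame_grams CARD('n) :: (complex ^ 'k ^ 'k) set)"
    by (intro components_eqpoll_of_connected_preimages[OF continuous_on_gram_map gram_map_image]
        connected_gram_map_preimage)
next
  show "connected (spherical_tight_frames :: (complex ^ 'k ^ 'n) set) \<longleftrightarrow>
      connected (frame_grams CARD('n) :: (complex ^ 'k ^ 'k) set)"
    by (rule connected_spherical_tight_frames_iff)
next
  assume "CARD('m) = CARD('k) - CARD('n)"
  then have "CARD('m) + CARD('n) = CARD('k)" "CARD('n) + CARD('m) = CARD('k)"
    using assms by linarith+
  then show "connected (spherical_tight_frames :: (complex ^ 'k ^ 'n) set) \<longleftrightarrow>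
      connected (spherical_tight_frames :: (complex ^ 'k ^ 'm) set)"
    unfolding connected_spherical_tight_frames_iff
    using frame_grams_complement[of "CARD('m)" "CARD('n)"]
      frame_grams_complement[of "CARD('n)" "CARD('m)"] by auto
qed

end
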